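(* Let $\Omega$ be a bounded open interval of $\mathbb{R}$, let $R>0$, $\mu>0$, and let $u^{in}=(f^{in},g^{in})\in L_\infty(\Omega,\mathbb{R}^2)$ have non-negative components. Let $u=(f,g)$ be a bounded weak solution, having properties (p1), (p2) and (p3) listed in the context, to the thin film Muskat problem $$\partial_t f=\partial_x\big(f\,\partial_x[(1+R)f+Rg]\big),\qquad \partial_t g=\mu R\,\partial_x\big(g\,\partial_x(f+g)\big)\quad\text{in }(0,\infty)\times\Omega,$$ with homogeneous Neumann boundary conditions and initial condition $(f^{in},g^{in})$. If $R\max\{1,\mu\}\in(0,1/(2e)]$, then $$\|f(t)\|_\infty\le\big(1+e\max\{1,\mu\}\big)\|f^{in}\|_\infty+\|g^{in}\|_\infty,\qquad t\ge0.$$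
   Context: The subscript $+$ on a function space denotes its positive cone (functions with a.e. non-negative components); $H^1(\Omega,\mathbb{R}^2)=H^1(\Omega)\times H^1(\Omega)$ and $H^1(\Omega,\mathbb{R}^2)'$ is its dual space, in which $L_2(\Omega,\mathbb{R}^2)$ is embedded through the $L_2$ pairing; $\|\cdot\|_\infty$ is the norm of $L_\infty(\Omega)$. A function with the regularity in (p1) is identified with its time-continuous representative. $L(r):=r\ln r-r+1$ for $r\ge0$ (with $L(0)=1$), and $\Phi_1(X):=L(X_1)+\frac1\mu L(X_2)$ for $X\in[0,\infty)^2$. For each integer $n\ge2$ set $\alpha_{k,n}:=R[k+\mu(n-k-1)]>0$ for $0\le k\le n-1$, $a_{0,n}:=1$, $$a_{j,n}:=\binom nj\prod_{k=0}^{j-1}\frac{k+\alpha_{k,n}}{\alpha_{k,n}},\quad1\le j\le n,\qquad\Phi_n(X):=\sum_{j=0}^na_{j,n}X_1^jX_2^{n-j},\quad X=(X_1,X_2)\in\mathbb{R}^2.$$ The properties are: (p1) for each $T>0$, $(f,g)\in L_{\infty,+}((0,T)\times\Omega,\mathbb{R}^2)\cap L_2((0,T),H^1(\Omega,\mathbb{R}^2))\cap W^1_2((0,T),H^1(\Omega,\mathbb{R}^2)')$; (p2) for all $\varphi\in H^1(\Omega)$ and $t\ge0$, $$\int_\Omega(f(t)-f^{in})\varphi\,\mathrm{d}x+\int_0^t\int_\Omega f\,\partial_x[(1+R)f+Rg]\,\partial_x\varphi\,\mathrm{d}x\,\mathrm{d}s=0,$$ $$\int_\Omega(g(t)-g^{in})\varphi\,\mathrm{d}x+\mu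 R\int_0^t\int_\Omega g\,\partial_x(f+g)\,\partial_x\varphi\,\mathrm{d}x\,\mathrm{d}s=0;$$ (p3) for all $t\ge0$: $\int_\Omega\Phi_1(u(t))\,\mathrm{d}x+\int_0^t\int_\Omega[|\partial_xf|^2+R|\partial_x(f+g)|^2]\,\mathrm{d}x\,\mathrm{d}s\le\int_\Omega\Phi_1(u^{in})\,\mathrm{d}x$; $\int_\Omega\Phi_n(u(t))\,\mathrm{d}x\le\int_\Omega\Phi_n(u^{in})\,\mathrm{d}x$ for every integer $n\ge2$; and $\|(f+g)(t)\|_\infty\le\frac{1+R}{R}\|f^{in}+g^{in}\|_\infty$. *)

theory Defs
  imports "HOL-Probability.Essential_Supremum"
begin

text \<open>
  All function spaces are sets of representatives equipped with a seminorm; equality of classes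
  is equality almost everywhere.
\<close>

subsection \<open>Lebesgue and Sobolev spaces on an open set of the real line\<close>

text \<open>Extended real valued; it is infinite for non-measurable functions.\<close>
definition Linf_norm :: "'a::euclidean_space set \<Rightarrow> ('a \<Rightarrow> real) \<Rightarrow> ereal" where
  "Linf_norm S h = esssup (lebesgue_on S) (\<lambda>x. ereal \<bar>h x\<bar>)"

definition Linf_space :: "'a::euclidean_space set \<Rightarrow> ('a \<Rightarrow> real) set" where
  "Linf_space S = {h. h \<in> borel_measurable (lebesgue_on S) \<and> Linf_norm S h < \<infinity>}"

definition L2_space :: "real set \<Rightarrow> (real \<Rightarrow> real) set" where
  "L2_space \<Omega> = {h. h \<in> borel_measurable (lebesgue_on \<Omega>) \<and> integrable (lebesgue_on \<Omega>) (\<lambda>x. (h x)\<^sup>2)}"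

definition L2_norm :: "real set \<Rightarrow> (real \<Rightarrow> real) \<Rightarrow> real" where
  "L2_norm \<Omega> h = sqrt (LINT x|lebesgue_on \<Omega>. (h x)\<^sup>2)"

definition test_functions :: "real set \<Rightarrow> (real \<Rightarrow> real) set" where
  "test_functions \<Omega> = {\<psi>. (\<forall>n. (deriv ^^ n) \<psi> differentiable_on UNIV) \<and>
     (\<exists>K. compact K \<and> K \<subseteq> \<Omega> \<and> (\<forall>x. x \<notin> K \<longrightarrow> \<psi> x = 0))}"

definition locally_integrable :: "real set \<Rightarrow> (real \<Rightarrow> real) \<Rightarrow> bool" where
  "locally_integrable \<Omega> h \<longleftrightarrow> (\<forall>K. compact K \<and> K \<subseteq> \<Omega> \<longrightarrow> set_integrable lebesgue K h)"

definition has_weak_deriv :: "real set \<Rightarrow> (real \<Rightarrow> real) \<Rightarrow> (real \<Rightarrow> real) \<Rightarrow> bool" where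
  "has_weak_deriv \<Omega> h h' \<longleftrightarrow> locally_integrable \<Omega> h \<and> locally_integrable \<Omega> h' \<and>
     (\<forall>\<psi> \<in> test_functions \<Omega>.
        (LINT x|lebesgue_on \<Omega>. h x * deriv \<psi> x) = - (LINT x|lebesgue_on \<Omega>. h' x * \<psi> x))"

text \<open>A weak derivative is unique only almost everywhere, so this is one representative of it;
  it occurs below only under integrals over \<open>\<Omega>\<close>. It is arbitrary if \<open>h\<close> is not weakly differentiable.\<close>
definition wderiv :: "real set \<Rightarrow> (real \<Rightarrow> real) \<Rightarrow> real \<Rightarrow> real" where
  "wderiv \<Omega> h = (SOME h'. has_weak_deriv \<Omega> h h')"

definition H1_space :: "real set \<Rightarrow> (real \<Rightarrow> real) set" where
  "H1_space \<Omega> = {h \<in> L2_space \<Omega>. \<exists>h' \<in> L2_space \<Omega>. has_weak_deriv \<Omega> h h'}"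

definition H1_norm :: "real set \<Rightarrow> (real \<Rightarrow> real) \<Rightarrow> real" where
  "H1_norm \<Omega> h = sqrt ((L2_norm \<Omega> h)\<^sup>2 + (L2_norm \<Omega> (wderiv \<Omega> h))\<^sup>2)"

text \<open>Only the values of a functional on \<open>H\<^sup>1(\<Omega>)\<close> matter.\<close>
definition H1_dual_space :: "real set \<Rightarrow> ((real \<Rightarrow> real) \<Rightarrow> real) set" where
  "H1_dual_space \<Omega> = {l.
     (\<forall>\<phi> \<in> H1_space \<Omega>. \<forall>\<psi> \<in> H1_space \<Omega>. \<forall>c d.
        l (\<lambda>x. c * \<phi> x + d * \<psi> x) = c * l \<phi> + d * l \<psi>) \<and>
     (\<exists>C. \<forall>\<phi> \<in> H1_space \<Omega>. \<bar>l \<phi>\<bar> \<le> C * H1_norm \<Omega> \<phi>)}"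

definition H1_dual_norm :: "real set \<Rightarrow> ((real \<Rightarrow> real) \<Rightarrow> real) \<Rightarrow> real" where
  "H1_dual_norm \<Omega> l = (SUP \<phi> \<in> {\<phi> \<in> H1_space \<Omega>. H1_norm \<Omega> \<phi> \<le> 1}. \<bar>l \<phi>\<bar>)"

definition L2_embedding :: "real set \<Rightarrow> (real \<Rightarrow> real) \<Rightarrow> (real \<Rightarrow> real) \<Rightarrow> real" where
  "L2_embedding \<Omega> h = (\<lambda>\<phi>. LINT x|lebesgue_on \<Omega>. h x * \<phi> x)"

subsection \<open>Square integrable functions of time with values in a function space\<close>

text \<open>
  Here \<open>V\<close> is a linear space of real valued functions with seminorm \<open>N\<close>; it is used with \<open>H\<^sup>1(\<Omega>)\<close>
  and with its dual. Measurability is strong (Bochner) measurability.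
\<close>

definition bochner_simple :: "real set \<Rightarrow> ('c \<Rightarrow> real) set \<Rightarrow> (real \<Rightarrow> 'c \<Rightarrow> real) \<Rightarrow> bool" where
  "bochner_simple I V s \<longleftrightarrow>
     (\<exists>(m::nat) A h. (\<forall>i<m. A i \<in> sets (lebesgue_on I) \<and> h i \<in> V) \<and>
        s = (\<lambda>t y. \<Sum>i<m. indicator (A i) t * h i y))"

definition bochner_measurable ::
  "real set \<Rightarrow> ('c \<Rightarrow> real) set \<Rightarrow> (('c \<Rightarrow> real) \<Rightarrow> real) \<Rightarrow> (real \<Rightarrow> 'c \<Rightarrow> real) \<Rightarrow> bool" where
  "bochner_measurable I V N u \<longleftrightarrow>
     (\<exists>s. (\<forall>n::nat. bochner_simple I V (s n)) \<and>
        (AE t in lebesgue_on I. u t \<in> V \<and> (\<lambda>n. N (\<lambda>y. u t y - s n t y)) \<longlonglongrightarrow> 0))"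

definition bochner_L2 ::
  "real set \<Rightarrow> ('c \<Rightarrow> real) set \<Rightarrow> (('c \<Rightarrow> real) \<Rightarrow> real) \<Rightarrow> (real \<Rightarrow> 'c \<Rightarrow> real) set" where
  "bochner_L2 I V N =
     {u. bochner_measurable I V N u \<and> integrable (lebesgue_on I) (\<lambda>t. (N (u t))\<^sup>2)}"

definition L2_H1 :: "real \<Rightarrow> real set \<Rightarrow> (real \<Rightarrow> real \<Rightarrow> real) set" where
  "L2_H1 T \<Omega> = bochner_L2 {0<..<T} (H1_space \<Omega>) (H1_norm \<Omega>)"

definition L2_H1_dual :: "real \<Rightarrow> real set \<Rightarrow> (real \<Rightarrow> (real \<Rightarrow> real) \<Rightarrow> real) set" where
  "L2_H1_dual T \<Omega> = bochner_L2 {0<..<T} (H1_dual_space \<Omega>) (H1_dual_norm \<Omega>)"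

text \<open>The identity of Bochner integrals in the dual space defining the distributional time derivative
  is stated by evaluating it at every element of \<open>H\<^sup>1(\<Omega>)\<close>.\<close>
definition W12_H1_dual :: "real \<Rightarrow> real set \<Rightarrow> (real \<Rightarrow> (real \<Rightarrow> real) \<Rightarrow> real) set" where
  "W12_H1_dual T \<Omega> = {u \<in> L2_H1_dual T \<Omega>. \<exists>v \<in> L2_H1_dual T \<Omega>.
     \<forall>\<psi> \<in> test_functions {0<..<T}. \<forall>\<phi> \<in> H1_space \<Omega>.
       (LINT t|lebesgue_on {0<..<T}. deriv \<psi> t * u t \<phi>)
         = - (LINT t|lebesgue_on {0<..<T}. \<psi> t * v t \<phi>)}"

subsection \<open>Bounded weak solutions of the thin film Muskat problem\<close>

text \<open>A function of time and space is written \<open>f t x\<close>, and \<open>f t\<close> is its value at time \<open>t\<close>. Since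
  spaces of pairs are products, regularity is required of each component.\<close>
definition muskat_regularity :: "real set \<Rightarrow> (real \<Rightarrow> real \<Rightarrow> real) \<Rightarrow> bool" where
  "muskat_regularity \<Omega> f \<longleftrightarrow> (\<forall>T>0.
     (\<lambda>(t, x). f t x) \<in> Linf_space ({0<..<T} \<times> \<Omega>) \<and>
     (AE p in lebesgue_on ({0<..<T} \<times> \<Omega>). 0 \<le> f (fst p) (snd p)) \<and>
     f \<in> L2_H1 T \<Omega> \<and>
     (\<lambda>t. L2_embedding \<Omega> (f t)) \<in> W12_H1_dual T \<Omega>)"

text \<open>\<open>L\<^sub>2((0,T), H\<^sup>1) \<inter> W\<^sup>1\<^sub>2((0,T), (H\<^sup>1)')\<close> embeds into \<open>C([0,T], L\<^sub>2)\<close>; this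
  selects the continuous representative, so that \<open>f t\<close> is meaningful for every \<open>t \<ge> 0\<close>.\<close>
definition L2_time_continuous :: "real set \<Rightarrow> (real \<Rightarrow> real \<Rightarrow> real) \<Rightarrow> bool" where
  "L2_time_continuous \<Omega> f \<longleftrightarrow> (\<forall>t\<ge>0. f t \<in> L2_space \<Omega> \<and>
     ((\<lambda>s. L2_norm \<Omega> (\<lambda>x. f s x - f t x)) \<longlongrightarrow> 0) (at t within {0..}))"

definition muskat_weak_formulation ::
  "real set \<Rightarrow> real \<Rightarrow> real \<Rightarrow> (real \<Rightarrow> real) \<Rightarrow> (real \<Rightarrow> real) \<Rightarrow>
     (real \<Rightarrow> real \<Rightarrow> real) \<Rightarrow> (real \<Rightarrow> real \<Rightarrow> real) \<Rightarrow> bool" where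
  "muskat_weak_formulation \<Omega> R \<mu> fin gin f g \<longleftrightarrow> (\<forall>\<phi> \<in> H1_space \<Omega>. \<forall>t\<ge>0.
     (LINT x|lebesgue_on \<Omega>. (f t x - fin x) * \<phi> x)
       + (LINT s|lebesgue_on {0..t}. LINT x|lebesgue_on \<Omega>.
            f s x * wderiv \<Omega> (\<lambda>y. (1 + R) * f s y + R * g s y) x * wderiv \<Omega> \<phi> x) = 0 \<and>
     (LINT x|lebesgue_on \<Omega>. (g t x - gin x) * \<phi> x)
       + \<mu> * R * (LINT s|lebesgue_on {0..t}. LINT x|lebesgue_on \<Omega>.
            g s x * wderiv \<Omega> (\<lambda>y. f s y + g s y) x * wderiv \<Omega> \<phi> x) = 0)"

text \<open>\<open>L 0 = 1\<close>, because \<open>ln 0 = 0\<close>.\<close>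
definition L :: "real \<Rightarrow> real" where
  "L r = r * ln r - r + 1"

definition Phi1 :: "real \<Rightarrow> real \<Rightarrow> real \<Rightarrow> real" where
  "Phi1 \<mu> X1 X2 = L X1 + (1 / \<mu>) * L X2"

definition alpha :: "real \<Rightarrow> real \<Rightarrow> nat \<Rightarrow> nat \<Rightarrow> real" where
  "alpha R \<mu> k n = R * (real k + \<mu> * (real n - real k - 1))"

text \<open>\<open>acoeff R \<mu> 0 n = 1\<close>, by the empty product.\<close>
definition acoeff :: "real \<Rightarrow> real \<Rightarrow> nat \<Rightarrow> nat \<Rightarrow> real" where
  "acoeff R \<mu> j n = real (n choose j) * (\<Prod>k<j. (real k + alpha R \<mu> k n) / alpha R \<mu> k n)"

definition Phi :: "real \<Rightarrow> real \<Rightarrow> nat \<Rightarrow> real \<Rightarrow> real \<Rightarrow> real" where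
  "Phi R \<mu> n X1 X2 = (\<Sum>j\<le>n. acoeff R \<mu> j n * X1 ^ j * X2 ^ (n - j))"

definition muskat_estimates ::
  "real set \<Rightarrow> real \<Rightarrow> real \<Rightarrow> (real \<Rightarrow> real) \<Rightarrow> (real \<Rightarrow> real) \<Rightarrow>
     (real \<Rightarrow> real \<Rightarrow> real) \<Rightarrow> (real \<Rightarrow> real \<Rightarrow> real) \<Rightarrow> bool" where
  "muskat_estimates \<Omega> R \<mu> fin gin f g \<longleftrightarrow> (\<forall>t\<ge>0.
     (LINT x|lebesgue_on \<Omega>. Phi1 \<mu> (f t x) (g t x))
       + (LINT s|lebesgue_on {0..t}. LINT x|lebesgue_on \<Omega>.
            (wderiv \<Omega> (f s) x)\<^sup>2 + R * (wderiv \<Omega> (\<lambda>y. f s y + g s y) x)\<^sup>2)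
       \<le> (LINT x|lebesgue_on \<Omega>. Phi1 \<mu> (fin x) (gin x)) \<and>
     (\<forall>n\<ge>2. (LINT x|lebesgue_on \<Omega>. Phi R \<mu> n (f t x) (g t x))
       \<le> (LINT x|lebesgue_on \<Omega>. Phi R \<mu> n (fin x) (gin x))) \<and>
     Linf_norm \<Omega> (\<lambda>x. f t x + g t x)
       \<le> ereal ((1 + R) / R) * Linf_norm \<Omega> (\<lambda>x. fin x + gin x))"

definition bounded_weak_solution ::
  "real set \<Rightarrow> real \<Rightarrow> real \<Rightarrow> (real \<Rightarrow> real) \<Rightarrow> (real \<Rightarrow> real) \<Rightarrow>
     (real \<Rightarrow> real \<Rightarrow> real) \<Rightarrow> (real \<Rightarrow> real \<Rightarrow> real) \<Rightarrow> bool" where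
  "bounded_weak_solution \<Omega> R \<mu> fin gin f g \<longleftrightarrow>
     muskat_regularity \<Omega> f \<and> muskat_regularity \<Omega> g \<and>
     L2_time_continuous \<Omega> f \<and> L2_time_continuous \<Omega> g \<and>
     muskat_weak_formulation \<Omega> R \<mu> fin gin f g \<and>
     muskat_estimates \<Omega> R \<mu> fin gin f g"

end

theory Submission
  imports Defs
begin

text \<open>
  Every factor \<open>(k + \<alpha>\<^sub>k) / \<alpha>\<^sub>k\<close> is at least \<open>1\<close>, so \<open>a\<^sub>j \<le> (n choose j) a\<^sub>n\<close>. Hence
  \<open>a\<^sub>n X\<^sub>1\<^sup>n \<le> \<Phi>\<^sub>n(X) \<le> a\<^sub>n (X\<^sub>1 + X\<^sub>2)\<^sup>n\<close> on the positive cone, and the decay of \<open>\<integral> \<Phi>\<^sub>n\<close> bounds the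
  \<open>L\<^sub>n\<close> norm of \<open>f(t)\<close> by that of the sum of the initial data. Letting \<open>n\<close> tend to infinity gives
  \<open>\<parallel>f(t)\<parallel>\<^sub>\<infinity> \<le> \<parallel>f\<^sup>i\<^sup>n\<parallel>\<^sub>\<infinity> + \<parallel>g\<^sup>i\<^sup>n\<parallel>\<^sub>\<infinity>\<close>, which is stronger than the claim.
\<close>

section \<open>Size of the coefficients and of \<open>Phi\<close> on the positive cone\<close>

lemma alpha_pos:
  assumes "R > 0" "\<mu> > 0" "n \<ge> 2" "k < n"
  shows "alpha R \<mu> k n > 0"
proof (cases "k = 0")
  case True
  then show ?thesis
    using assms by (simp add: alpha_def)
next
  case False
  \<comment> \<open>This term vanishes at \<open>k = n - 1\<close>, where positivity must come from
    \<open>k\<close>; at \<open>k = 0\<close> it is the other way round, and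
    \<open>n \<ge> 2\<close> makes the term positive.\<close>
  have "0 \<le> \<mu> * (real n - real k - 1)"
    using assms by (intro mult_nonneg_nonneg) auto
  with False have "0 < real k + \<mu> * (real n - real k - 1)"
    by linarith
  then show ?thesis
    using assms by (simp add: alpha_def)
qed

lemma acoeff_factor_ge_1:
  assumes "R > 0" "\<mu> > 0" "n \<ge> 2" "k < n"
  shows "(real k + alpha R \<mu> k n) / alpha R \<mu> k n \<ge> 1"
  using alpha_pos[OF assms] by (simp add: field_simps)

lemma acoeff_pos:
  assumes "R > 0" "\<mu> > 0" "n \<ge> 2" "j \<le> n"
  shows "acoeff R \<mu> j n > 0"
proof -
  have "(real k + alpha R \<mu> k n) / alpha R \<mu> k n > 0" if "k < j" for k
    using acoeff_factor_ge_1[of R \<mu> n k] assms that by simp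
  then show ?thesis
    using assms by (auto simp: acoeff_def intro!: mult_pos_pos prod_pos)
qed

lemma acoeff_le_binomial_mult:
  assumes "R > 0" "\<mu> > 0" "n \<ge> 2" "j \<le> n"
  shows "acoeff R \<mu> j n \<le> real (n choose j) * acoeff R \<mu> n n"
proof -
  let ?q = "\<lambda>k. (real k + alpha R \<mu> k n) / alpha R \<mu> k n"
  have q: "1 \<le> ?q k" if "k < n" for k
    using acoeff_factor_ge_1 assms that by simp
  have "prod ?q {..<j} \<le> prod ?q {..<n}"
  proof (rule prod_mono2)
    show "1 \<le> ?q k" if "k \<in> {..<n} - {..<j}" for k
      using q that by simp
    show "0 \<le> ?q k" if "k \<in> {..<j}" for k
      using q[of k] that assms(4) by simp
  qed (use assms in auto)
  then show ?thesis
    by (simp add: acoeff_def mult_left_mono)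
qed

lemma Phi_ge:
  assumes "R > 0" "\<mu> > 0" "n \<ge> 2" "x \<ge> 0" "y \<ge> 0"
  shows "acoeff R \<mu> n n * x ^ n \<le> Phi R \<mu> n x y"
proof -
  \<comment> \<open>The trivial factor \<open>y ^ (n - n)\<close> gives the left-hand side the exact
    form of the summand \<open>j = n\<close>; the others are non-negative.\<close>
  have "acoeff R \<mu> n n * x ^ n * y ^ (n - n) \<le> Phi R \<mu> n x y"
    unfolding Phi_def using assms
    by (intro member_le_sum mult_nonneg_nonneg) (auto intro!: less_imp_le[OF acoeff_pos])
  then show ?thesis
    by simp
qed

text \<open>The binomial majorants of the coefficients turn the sum into the expansion of
  \<open>(x + y) ^ n\<close>.\<close>

lemma Phi_le:
  assumes "R > 0" "\<mu> > 0" "n \<ge> 2" "x \<ge> 0" "y \<ge> 0"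
  shows "Phi R \<mu> n x y \<le> acoeff R \<mu> n n * (x + y) ^ n"
proof -
  have "Phi R \<mu> n x y \<le> (\<Sum>j\<le>n. real (n choose j) * acoeff R \<mu> n n * x ^ j * y ^ (n - j))"
    unfolding Phi_def using assms
    by (intro sum_mono mult_right_mono acoeff_le_binomial_mult) auto
  also have "\<dots> = acoeff R \<mu> n n * (x + y) ^ n"
    unfolding binomial_ring sum_distrib_left by (intro sum.cong) auto
  finally show ?thesis .
qed

section \<open>From integrals of powers to a bound almost everywhere\<close>

text \<open>Markov's inequality for \<open>h ^ n\<close> at level \<open>(c + e) ^ n\<close> bounds
  the measure of the set where \<open>h \<ge> c + e\<close> by \<open>(c / (c + e)) ^ n * K\<close>.
  As \<open>K\<close> is independent of \<open>n\<close>, this tends to \<open>0\<close>.\<close>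

lemma (in finite_measure) AE_le_of_integral_power_le:
  fixes h :: "'a \<Rightarrow> real"
  assumes [measurable]: "h \<in> borel_measurable M"
    and nonneg: "AE x in M. 0 \<le> h x" and c: "c \<ge> 0"
    and int: "\<And>n. n \<ge> N \<Longrightarrow> integrable M (\<lambda>x. h x ^ n)"
    and le: "\<And>n. n \<ge> N \<Longrightarrow> (\<integral>x. h x ^ n \<partial>M) \<le> c ^ n * K"
  shows "AE x in M. h x \<le> c"
proof -
  have less: "AE x in M. h x < c + e" if "e > 0" for e
  proof -
    let ?E = "{x \<in> space M. c + e \<le> h x}"
    have bound: "measure M ?E \<le> (c / (c + e)) ^ n * K" if n: "n \<ge> N" for n
    proof -
      have "measure M ?E \<le> measure M {x \<in> space M. (c + e) ^ n \<le> h x ^ n}"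
        using c \<open>e > 0\<close> by (intro finite_measure_mono) (auto intro!: power_mono)
      also have "\<dots> \<le> (\<integral>x. h x ^ n \<partial>M) / (c + e) ^ n"
        using nonneg c \<open>e > 0\<close> int[OF n]
        by (intro integral_Markov_inequality_measure[where A = "{}"]) auto
      also have "\<dots> \<le> (c ^ n * K) / (c + e) ^ n"
        using c \<open>e > 0\<close> le[OF n] by (intro divide_right_mono) auto
      finally show ?thesis
        by (simp add: power_divide)
    qed
    have "(\<lambda>n. (c / (c + e)) ^ n * K) \<longlonglongrightarrow> 0 * K"
      using c \<open>e > 0\<close> by (intro tendsto_mult tendsto_const LIMSEQ_power_zero) auto
    then have "measure M ?E \<le> 0 * K"
      using bound by (rule tendsto_lowerbound[OF _ eventually_sequentiallyI]) auto
    then have "emeasure M ?E = 0"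
      by (simp add: emeasure_eq_measure measure_le_0_iff)
    then show ?thesis
      by (intro AE_I[where N = ?E]) (auto simp: not_less)
  qed
  \<comment> \<open>Restricting \<open>e\<close> to a sequence tending to \<open>0\<close> keeps the
    union of the exceptional sets null.\<close>
  have "AE x in M. \<forall>k. h x < c + inverse (real (Suc k))"
    by (subst AE_all_countable) (auto intro: less)
  then show ?thesis
  proof eventually_elim
    case (elim x)
    show "h x \<le> c"
    proof (rule ccontr)
      assume "\<not> h x \<le> c"
      then obtain k where "inverse (real (Suc k)) < h x - c"
        using reals_Archimedean[of "h x - c"] by auto
      with elim[rule_format, of k] show False
        by simp
    qed
  qed
qed

section \<open>Almost everywhere statements in time and space\<close>

lemma finite_measure_lebesgue_on_Ioo: "finite_measure (lebesgue_on {a<..<b::real})"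
  using emeasure_bounded_finite[of "{a<..<b}"]
  by (intro finite_measureI) (simp add: emeasure_restrict_space less_top)

text \<open>Completion does not change which properties hold almost everywhere. The passage to
  \<open>lborel\<close> opens the way to Fubini, because \<open>lborel\<close> on a product space is
  itself a product measure.\<close>

lemma AE_lebesgue_on_iff:
  assumes "S \<in> sets lebesgue"
  shows "(AE x in lebesgue_on S. P x) \<longleftrightarrow> (AE x in lborel. x \<in> S \<longrightarrow> P x)"
  using assms by (simp add: AE_restrict_space_iff AE_completion_iff)

lemma AE_lebesgue_on_Times:
  fixes A :: "'a::euclidean_space set" and B :: "'b::euclidean_space set"
  assumes [measurable]: "A \<in> sets borel" "B \<in> sets borel"
    and "AE p in lebesgue_on (A \<times> B). P (fst p) (snd p)"
  shows "AE s in lebesgue_on A. AE x in lebesgue_on B. P s x"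
proof -
  have "A \<times> B \<in> sets borel"
    by (simp add: borel_Times)
  then have "A \<times> B \<in> sets lebesgue"
    by simp
  with assms(3) have "AE p in lborel \<Otimes>\<^sub>M lborel. p \<in> A \<times> B \<longrightarrow> P (fst p) (snd p)"
    by (simp only: AE_lebesgue_on_iff lborel_prod)
  then have "AE s in lborel. AE x in lborel. (s, x) \<in> A \<times> B \<longrightarrow> P s x"
    using lborel_pair.AE_pair by fastforce
  then have "AE s in lborel. s \<in> A \<longrightarrow> (AE x in lborel. x \<in> B \<longrightarrow> P s x)"
    by (rule eventually_mono) (intro impI, simp)
  then show ?thesis
    by (simp add: AE_lebesgue_on_iff)
qed

text \<open>A non-empty open interval has positive measure, so it meets every set of full measure.
  This supplies good times arbitrarily close to a given one.\<close>

lemma AE_lborel_obtains_Ioo: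
  fixes a b :: real
  assumes "AE s in lborel. P s" "a < b"
  obtains s where "a < s" "s < b" "P s"
proof -
  have "\<exists>s. a < s \<and> s < b \<and> P s"
  proof (rule ccontr)
    assume "\<nexists>s. a < s \<and> s < b \<and> P s"
    then have "AE s in lborel. s \<notin> {a<..<b}"
      using assms(1) by (auto elim!: eventually_mono)
    then have "{a<..<b} \<in> null_sets lborel"
      by (subst AE_iff_null_sets) auto
    with \<open>a < b\<close> show False
      by (simp add: null_sets_def)
  qed
  with that show thesis by blast
qed

section \<open>Non-negativity at every time\<close>

lemma L2_space_diff:
  assumes "h \<in> L2_space \<Omega>" "k \<in> L2_space \<Omega>"
  shows "(\<lambda>x. h x - k x) \<in> L2_space \<Omega>"
proof -
  have [measurable]: "h \<in> borel_measurable (lebesgue_on \<Omega>)" "k \<in> borel_measurable (lebesgue_on \<Omega>)"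
    and int: "integrable (lebesgue_on \<Omega>) (\<lambda>x. (h x)\<^sup>2)" "integrable (lebesgue_on \<Omega>) (\<lambda>x. (k x)\<^sup>2)"
    using assms by (auto simp: L2_space_def)
  have "integrable (lebesgue_on \<Omega>) (\<lambda>x. (h x - k x)\<^sup>2)"
  proof (rule Bochner_Integration.integrable_bound)
    show "integrable (lebesgue_on \<Omega>) (\<lambda>x. 2 * (h x)\<^sup>2 + 2 * (k x)\<^sup>2)"
      using int by simp
    have "(h x - k x)\<^sup>2 \<le> 2 * (h x)\<^sup>2 + 2 * (k x)\<^sup>2" for x
      using zero_le_power2[of "h x + k x"] by (simp add: power2_eq_square algebra_simps)
    then show "AE x in lebesgue_on \<Omega>. norm ((h x - k x)\<^sup>2) \<le> norm (2 * (h x)\<^sup>2 + 2 * (k x)\<^sup>2)"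
      by (intro AE_I2) simp
  qed simp
  then show ?thesis
    by (simp add: L2_space_def)
qed

text \<open>(p1) gives non-negativity only for almost every time; continuity in \<open>L\<^sub>2\<close> extends it.\<close>
lemma nonneg_at_every_time:
  assumes reg: "muskat_regularity \<Omega> h" and cont: "L2_time_continuous \<Omega> h"
    and [measurable]: "\<Omega> \<in> sets borel" and t: "t \<ge> 0"
  shows "AE x in lebesgue_on \<Omega>. 0 \<le> h t x"
proof -
  let ?M = "lebesgue_on \<Omega>"
  \<comment> \<open>The squared negative part of \<open>h t\<close>; the aim is to show that its
    integral is \<open>0\<close>.\<close>
  let ?neg = "\<lambda>x. (min 0 (h t x))\<^sup>2"
  have L2: "h s \<in> L2_space \<Omega>" if "s \<ge> 0" for s
    using cont that by (simp add: L2_time_continuous_def)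
  have [measurable]: "h t \<in> borel_measurable ?M" and intt: "integrable ?M (\<lambda>x. (h t x)\<^sup>2)"
    using L2[OF t] by (auto simp: L2_space_def)
  have int: "integrable ?M ?neg"
    by (rule Bochner_Integration.integrable_bound[OF intt]) (auto simp: min_def)
  have small: "(LINT x|?M. ?neg x) \<le> e\<^sup>2" if e: "e > 0" for e
  proof -
    have "((\<lambda>s. L2_norm \<Omega> (\<lambda>x. h s x - h t x)) \<longlongrightarrow> 0) (at t within {0..})"
      using cont t by (simp add: L2_time_continuous_def)
    then have "eventually (\<lambda>s. L2_norm \<Omega> (\<lambda>x. h s x - h t x) < e) (at t within {0..})"
      using e by (simp add: order_tendsto_iff)
    then obtain d where d: "d > 0"
      and close: "\<And>s. \<lbrakk>s \<ge> 0; s \<noteq> t; dist s t < d\<rbrakk> \<Longrightarrow> L2_norm \<Omega> (\<lambda>x. h s x - h t x) < e"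
      by (auto simp: eventually_at)
    \<comment> \<open>The horizon \<open>t + d\<close> leaves room for a good time to the right of
      \<open>t\<close>, which also covers \<open>t = 0\<close>.\<close>
    have "AE p in lebesgue_on ({0<..<t + d} \<times> \<Omega>). 0 \<le> h (fst p) (snd p)"
      using reg t d by (simp add: muskat_regularity_def)
    then have "AE s in lebesgue_on {0<..<t + d}. AE x in ?M. 0 \<le> h s x"
      by (intro AE_lebesgue_on_Times) auto
    then have "AE s in lborel. s \<in> {0<..<t + d} \<longrightarrow> (AE x in ?M. 0 \<le> h s x)"
      by (simp add: AE_lebesgue_on_iff)
    then obtain s where s: "t < s" "s < t + d"
      and "s \<in> {0<..<t + d} \<longrightarrow> (AE x in ?M. 0 \<le> h s x)"
      by (rule AE_lborel_obtains_Ioo[where a = t and b = "t + d"]) (use d in auto)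
    with t have pos: "AE x in ?M. 0 \<le> h s x"
      by simp
    have norm: "L2_norm \<Omega> (\<lambda>x. h s x - h t x) < e"
      using s t by (intro close) (auto simp: dist_real_def)
    have "integrable ?M (\<lambda>x. (h s x - h t x)\<^sup>2)"
      using L2_space_diff[OF L2 L2, of s t] s t by (simp add: L2_space_def)
    then have "(LINT x|?M. ?neg x) \<le> (LINT x|?M. (h s x - h t x)\<^sup>2)"
    proof (rule integral_mono_AE[OF int])
      show "AE x in ?M. ?neg x \<le> (h s x - h t x)\<^sup>2"
        using pos
      proof eventually_elim
        case (elim x)
        \<comment> \<open>The left-hand side is the distance from \<open>h t x\<close> to the
          half-line of non-negative numbers, which contains \<open>h s x\<close>.\<close>
        then have "\<bar>min 0 (h t x)\<bar> \<le> \<bar>h s x - h t x\<bar>"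
          by linarith
        then show ?case
          by (simp only: abs_le_square_iff)
      qed
    qed
    also have "\<dots> = (L2_norm \<Omega> (\<lambda>x. h s x - h t x))\<^sup>2"
      by (simp add: L2_norm_def)
    also have "\<dots> \<le> e\<^sup>2"
      using norm by (intro power_mono) (auto simp: L2_norm_def)
    finally show ?thesis .
  qed
  have "(LINT x|?M. ?neg x) \<le> 0"
  proof (rule field_le_epsilon)
    fix e :: real assume "e > 0"
    then show "(LINT x|?M. ?neg x) \<le> 0 + e"
      using small[of "sqrt e"] by simp
  qed
  then have "(LINT x|?M. ?neg x) = 0"
    by (intro antisym integral_nonneg_AE) auto
  then have "AE x in ?M. ?neg x = 0"
    using int by (subst (asm) integral_nonneg_eq_0_iff_AE) auto
  then show ?thesis
    by (auto simp: min_def elim!: eventually_mono split: if_splits)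
qed

section \<open>Essential suprema\<close>

lemma AE_abs_le_of_Linf_norm_le:
  assumes "Linf_norm S h \<le> ereal c"
  shows "AE x in lebesgue_on S. \<bar>h x\<bar> \<le> c"
proof -
  have "AE x in lebesgue_on S. ereal \<bar>h x\<bar> \<le> Linf_norm S h"
    unfolding Linf_norm_def by (rule esssup_AE)
  then show ?thesis
  proof eventually_elim
    case (elim x)
    then have "ereal \<bar>h x\<bar> \<le> ereal c"
      using assms by (rule order_trans)
    then show ?case by simp
  qed
qed

lemma Linf_norm_le:
  assumes [measurable]: "h \<in> borel_measurable (lebesgue_on S)"
    and "AE x in lebesgue_on S. \<bar>h x\<bar> \<le> c"
  shows "Linf_norm S h \<le> ereal c"
  unfolding Linf_norm_def using assms(2) by (intro esssup_I) auto

text \<open>Over a null space the essential supremum of a measurable function is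
  \<open>-\<infinity>\<close>; the hypothesis excludes this case.\<close>

lemma Linf_norm_nonneg:
  assumes "emeasure (lebesgue_on S) (space (lebesgue_on S)) \<noteq> 0"
  shows "Linf_norm S h \<ge> 0"
proof -
  have "esssup (lebesgue_on S) (\<lambda>x. 0) \<le> esssup (lebesgue_on S) (\<lambda>x. ereal \<bar>h x\<bar>)"
    by (rule esssup_mono) auto
  then show ?thesis
    using assms by (simp add: Linf_norm_def esssup_const)
qed

section \<open>The bound on the first component\<close>

lemma Linf_norm_component_le:
  assumes "a < b" and \<Omega>: "\<Omega> = {a<..<b}" and R: "R > 0" and \<mu>: "\<mu> > 0"
    and fin0: "AE x in lebesgue_on \<Omega>. 0 \<le> fin x" and finp: "AE x in lebesgue_on \<Omega>. \<bar>fin x\<bar> \<le> p"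
    and gin0: "AE x in lebesgue_on \<Omega>. 0 \<le> gin x" and ginq: "AE x in lebesgue_on \<Omega>. \<bar>gin x\<bar> \<le> q"
    and [measurable]: "fin \<in> borel_measurable (lebesgue_on \<Omega>)"
      "gin \<in> borel_measurable (lebesgue_on \<Omega>)"
    and p: "p \<ge> 0" and q: "q \<ge> 0"
    and sol: "bounded_weak_solution \<Omega> R \<mu> fin gin f g" and t: "t \<ge> 0"
  shows "Linf_norm \<Omega> (f t) \<le> ereal (p + q)"
proof -
  let ?M = "lebesgue_on \<Omega>"
  interpret finite_measure ?M
    unfolding \<Omega> by (rule finite_measure_lebesgue_on_Ioo)
  have bor: "\<Omega> \<in> sets borel"
    by (simp add: \<Omega>)
  have f0: "AE x in ?M. 0 \<le> f t x" and g0: "AE x in ?M. 0 \<le> g t x"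
    using sol t bor by (auto intro!: nonneg_at_every_time simp: bounded_weak_solution_def)
  have [measurable]: "f t \<in> borel_measurable ?M" "g t \<in> borel_measurable ?M"
    using sol t by (auto simp: bounded_weak_solution_def L2_time_continuous_def L2_space_def)
  have est: "Linf_norm \<Omega> (\<lambda>x. f t x + g t x) \<le> ereal ((1 + R) / R) * Linf_norm \<Omega> (\<lambda>x. fin x + gin x)"
    and dec: "\<And>n. n \<ge> 2 \<Longrightarrow>
      (LINT x|?M. Phi R \<mu> n (f t x) (g t x)) \<le> (LINT x|?M. Phi R \<mu> n (fin x) (gin x))"
    using sol t by (auto simp: bounded_weak_solution_def muskat_estimates_def)
  \<comment> \<open>The crude bound on \<open>f + g\<close> from (p3) enters only through
    integrability, so its size does not affect the final constant.\<close>
  define B where "B = (1 + R) / R * (p + q)"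
  have B: "B \<ge> 0"
    using R p q by (simp add: B_def)
  have "Linf_norm \<Omega> (\<lambda>x. fin x + gin x) \<le> ereal (p + q)"
    using finp ginq by (intro Linf_norm_le) (auto elim!: eventually_elim2)
  then have "ereal ((1 + R) / R) * Linf_norm \<Omega> (\<lambda>x. fin x + gin x) \<le> ereal ((1 + R) / R) * ereal (p + q)"
    using R by (intro ereal_mult_left_mono) auto
  with est have "Linf_norm \<Omega> (\<lambda>x. f t x + g t x) \<le> ereal B"
    by (simp add: B_def)
  then have fgB: "AE x in ?M. \<bar>f t x + g t x\<bar> \<le> B"
    by (rule AE_abs_le_of_Linf_norm_le)
  have int_pow: "integrable ?M (\<lambda>x. f t x ^ n)" for n
  proof (rule integrable_const_bound[where B = "B ^ n"])
    show "AE x in ?M. norm (f t x ^ n) \<le> B ^ n"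
      using f0 g0 fgB by eventually_elim (auto simp: norm_power intro!: power_mono)
  qed simp
  \<comment> \<open>A non-integrable function would have integral \<open>0\<close> by default, and
    the decay estimate would then carry no information.\<close>
  have int_Phi: "integrable ?M (\<lambda>x. Phi R \<mu> n (f t x) (g t x))" if n: "n \<ge> 2" for n
  proof (rule integrable_const_bound[where B = "acoeff R \<mu> n n * B ^ n"])
    show "AE x in ?M. norm (Phi R \<mu> n (f t x) (g t x)) \<le> acoeff R \<mu> n n * B ^ n"
      using f0 g0 fgB
    proof eventually_elim
      case (elim x)
      have a: "acoeff R \<mu> n n > 0"
        using R \<mu> n by (simp add: acoeff_pos)
      have "0 \<le> acoeff R \<mu> n n * f t x ^ n"
        using a elim by simp
      also have "\<dots> \<le> Phi R \<mu> n (f t x) (g t x)"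
        using R \<mu> n elim by (intro Phi_ge) auto
      finally have "norm (Phi R \<mu> n (f t x) (g t x)) = Phi R \<mu> n (f t x) (g t x)"
        by simp
      also have "\<dots> \<le> acoeff R \<mu> n n * (f t x + g t x) ^ n"
        using R \<mu> n elim by (intro Phi_le) auto
      also have "\<dots> \<le> acoeff R \<mu> n n * B ^ n"
        using a elim by (intro mult_left_mono power_mono) auto
      finally show ?case .
    qed
  qed (simp add: Phi_def)
  have pow: "(LINT x|?M. f t x ^ n) \<le> (p + q) ^ n * measure ?M (space ?M)" if n: "n \<ge> 2" for n
  proof -
    have a: "acoeff R \<mu> n n > 0"
      using R \<mu> n by (simp add: acoeff_pos)
    have "acoeff R \<mu> n n * (LINT x|?M. f t x ^ n) = (LINT x|?M. acoeff R \<mu> n n * f t x ^ n)"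
      by simp
    also have "\<dots> \<le> (LINT x|?M. Phi R \<mu> n (f t x) (g t x))"
    proof (rule integral_mono_AE)
      show "AE x in ?M. acoeff R \<mu> n n * f t x ^ n \<le> Phi R \<mu> n (f t x) (g t x)"
        using f0 g0 by eventually_elim (use R \<mu> n in \<open>auto intro!: Phi_ge\<close>)
    qed (use int_pow int_Phi n in auto)
    also have "\<dots> \<le> (LINT x|?M. Phi R \<mu> n (fin x) (gin x))"
      using n by (rule dec)
    also have "\<dots> \<le> (LINT x|?M. acoeff R \<mu> n n * (p + q) ^ n)"
    \<comment> \<open>This form of monotonicity asks for integrability of the majorant alone,
      together with its non-negativity.\<close>
    proof (rule integral_mono_AE')
      show "AE x in ?M. Phi R \<mu> n (fin x) (gin x) \<le> acoeff R \<mu> n n * (p + q) ^ n"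
        using fin0 gin0 finp ginq
      proof eventually_elim
        case (elim x)
        then have "Phi R \<mu> n (fin x) (gin x) \<le> acoeff R \<mu> n n * (fin x + gin x) ^ n"
          using R \<mu> n by (intro Phi_le) auto
        also have "\<dots> \<le> acoeff R \<mu> n n * (p + q) ^ n"
          using a elim by (intro mult_left_mono power_mono) auto
        finally show ?case .
      qed
    qed (use a p q in auto)
    also have "\<dots> = acoeff R \<mu> n n * ((p + q) ^ n * measure ?M (space ?M))"
      by simp
    \<comment> \<open>The positive factor \<open>acoeff R \<mu> n n\<close> stands on both sides and
      cancels, so no trace of its growth in \<open>n\<close> remains.\<close>
    finally show ?thesis
      using a by simp
  qed
  have "AE x in ?M. f t x \<le> p + q"
    using f0 p q int_pow pow
    by (intro AE_le_of_integral_power_le[where N = 2 and K = "measure ?M (space ?M)"]) auto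
  with f0 show ?thesis
    by (intro Linf_norm_le) (auto elim!: eventually_elim2)
qed

theorem corollary1p3:
  fixes a b R \<mu> :: real
    and \<Omega> :: "real set"
    and fin gin :: "real \<Rightarrow> real"
    and f g :: "real \<Rightarrow> real \<Rightarrow> real"
  assumes "a < b" and "\<Omega> = {a<..<b}"
    and "R > 0" and "\<mu> > 0"
    and "fin \<in> Linf_space \<Omega>" and "AE x in lebesgue_on \<Omega>. 0 \<le> fin x"
    and "gin \<in> Linf_space \<Omega>" and "AE x in lebesgue_on \<Omega>. 0 \<le> gin x"
    and "bounded_weak_solution \<Omega> R \<mu> fin gin f g"
    and "R * max 1 \<mu> \<in> {0<..1 / (2 * exp 1)}"
  shows "\<forall>t\<ge>0. Linf_norm \<Omega> (f t)
           \<le> ereal (1 + exp 1 * max 1 \<mu>) * Linf_norm \<Omega> fin + Linf_norm \<Omega> gin"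
proof (intro allI impI)
  fix t :: real assume t: "t \<ge> 0"
  have "emeasure (lebesgue_on \<Omega>) (space (lebesgue_on \<Omega>)) \<noteq> 0"
    using assms(1,2) by (simp add: emeasure_restrict_space)
  then have nonneg: "Linf_norm \<Omega> h \<ge> 0" for h
    by (rule Linf_norm_nonneg)
  have fin: "fin \<in> borel_measurable (lebesgue_on \<Omega>)" "Linf_norm \<Omega> fin < \<infinity>"
    and gin: "gin \<in> borel_measurable (lebesgue_on \<Omega>)" "Linf_norm \<Omega> gin < \<infinity>"
    using assms(5,7) by (auto simp: Linf_space_def)
  \<comment> \<open>Being non-negative and finite, the norms of the initial data are real
    numbers.\<close>
  obtain p where p: "Linf_norm \<Omega> fin = ereal p" "p \<ge> 0"
    using nonneg[of fin] fin(2) by (cases "Linf_norm \<Omega> fin") auto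
  obtain q where q: "Linf_norm \<Omega> gin = ereal q" "q \<ge> 0"
    using nonneg[of gin] gin(2) by (cases "Linf_norm \<Omega> gin") auto
  have "Linf_norm \<Omega> (f t) \<le> ereal (p + q)"
    using assms fin gin p q t
    by (intro Linf_norm_component_le[where a = a and b = b and fin = fin and gin = gin])
      (auto intro!: AE_abs_le_of_Linf_norm_le)
  \<comment> \<open>The two sides differ by \<open>exp 1 * max 1 \<mu> * p\<close>, which is
    non-negative.\<close>
  also have "p + q \<le> (1 + exp 1 * max 1 \<mu>) * p + q"
    using p(2) by (simp add: algebra_simps)
  then have "ereal (p + q) \<le> ereal (1 + exp 1 * max 1 \<mu>) * Linf_norm \<Omega> fin + Linf_norm \<Omega> gin"
    by (simp add: p q)
  finally show "Linf_norm \<Omega> (f t) \<le> ereal (1 + exp 1 * max 1 \<mu>) * Linf_norm \<Omega> fin + Linf_norm \<Omega> gin" .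
qed

end
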